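(* Let $n\ge3$. For every position $x=(x_0,x_1,\ldots,x_n)$ of Exco-Nim with parameter $n$, the Sprague–Grundy value is $\mathcal{G}(x)=g(x)$, where, with $m=\min_{1\le i\le n}x_i$, $u=\sum_{i=0}^n x_i$, $y=u-nm$ and $z=\binom{y+1}{2}+1$, $$g(x)=\begin{cases}u, & \text{if } m<z,\\ (z-1)+\big((m-z)\bmod (y+1)\big), & \text{if } m\ge z.\end{cases}$$
   Context: Exco-Nim with parameter $n$: positions are tuples $x=(x_0,x_1,\ldots,x_n)$ of nonnegative integers. A legal move $x\to x'$ is to a tuple $x'$ of nonnegative integers with $x'_j\le x_j$ for all $j$, $\sum_j x'_j<\sum_j x_j$, and $x'_i=x_i$ for at least one index $1\le i\le n$. The Sprague–Grundy function is defined recursively by $\mathcal{G}(x)=\operatorname{mex}\{\mathcal{G}(x'): x\to x'\}$, where $\operatorname{mex}(S)$ is the smallest nonnegative integer not in $S$. Here $a\bmod b\in\{0,\ldots,b-1\}$. *)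

theory Defs
  imports Main
begin

text \<open>A position with parameter \<open>n\<close> is a list \<open>x\<close> of length \<open>n + 1\<close>; the entry \<open>x ! j\<close> is \<open>x\<^sub>j\<close>,
  so index \<open>0\<close> is the distinguished extra component.\<close>

definition exco_position :: "nat \<Rightarrow> nat list \<Rightarrow> bool" where
  "exco_position n x \<longleftrightarrow> length x = n + 1"

definition exco_move :: "nat \<Rightarrow> nat list \<Rightarrow> nat list \<Rightarrow> bool" where
  "exco_move n x x' \<longleftrightarrow>
     exco_position n x \<and> exco_position n x' \<and>
     (\<forall>j\<in>{0..n}. x' ! j \<le> x ! j) \<and>
     (\<Sum>j=0..n. x' ! j) < (\<Sum>j=0..n. x ! j) \<and>
     (\<exists>i\<in>{1..n}. x' ! i = x ! i)"

definition mex :: "nat set \<Rightarrow> nat" where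
  "mex S = (LEAST k. k \<notin> S)"

function exco_grundy :: "nat \<Rightarrow> nat list \<Rightarrow> nat" where
  "exco_grundy n x = mex (exco_grundy n ` {x'. exco_move n x x'})"
  by auto
termination
  by (relation "measure (\<lambda>(n, x). \<Sum>j=0..n. x ! j)") (auto simp: exco_move_def)

declare exco_grundy.simps [simp del]

definition exco_min :: "nat \<Rightarrow> nat list \<Rightarrow> nat" where
  "exco_min n x = Min ((\<lambda>i. x ! i) ` {1..n})"

text \<open>On a position, \<open>n * m \<le> u\<close> because \<open>m\<close> is a lower bound for \<open>n\<close> of the summands of \<open>u\<close>, so the
  natural-number subtraction \<open>u - n * m\<close> does not truncate; \<open>m - z\<close> is used only when \<open>m \<ge> z\<close>,
  and \<open>z \<ge> 1\<close>.\<close>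

definition exco_formula :: "nat \<Rightarrow> nat list \<Rightarrow> nat" where
  "exco_formula n x =
     (let m = exco_min n x;
          u = (\<Sum>i=0..n. x ! i);
          y = u - n * m;
          z = ((y + 1) choose 2) + 1
      in if m < z then u else (z - 1) + ((m - z) mod (y + 1)))"

end

theory Submission
  imports Defs
begin

text \<open>Write \<open>T y = (y + 1 choose 2)\<close>. The formula depends only on \<open>m\<close> and \<open>y\<close>: a position is long if
  \<open>m \<le> T y\<close>, with value \<open>u\<close>, and short otherwise, with value in \<open>{T y..T y + y}\<close>; these
  intervals partition the natural numbers.

  No move preserves the value: a kept pile is at least \<open>m\<close>, so \<open>u' \<ge> m\<close> and \<open>y' \<ge> m - m'\<close>.
  The first inequality separates a short position from a long successor, the second one two short
  positions with the same \<open>y\<close> and with \<open>m\<close> congruent modulo \<open>y + 1\<close>.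

  Conversely, for \<open>n \<ge> 3\<close> a pair \<open>(m', u')\<close> with \<open>m' \<le> m\<close> and \<open>u' < u\<close> is realised by a move
  as soon as \<open>y' \<ge> m - m'\<close> and \<open>u' \<le> u - (m - m')\<close>. From a short
  position all smaller values are then attained at short positions; from a long one, the values
  \<open>v < m\<close> are attained at short positions and the values \<open>v \<ge> m\<close> at long ones.\<close>

section \<open>Mex, and sums with prescribed total\<close>

lemma mex_eqI:
  assumes "v \<notin> S" and "\<And>w. w < v \<Longrightarrow> w \<in> S"
  shows "mex S = v"
  unfolding mex_def using assms by (intro Least_equality) (auto simp: not_less[symmetric])

lemma exists_between_with_sum:
  fixes lo hi :: "'a \<Rightarrow> nat"
  assumes "finite A" and "\<And>k. k \<in> A \<Longrightarrow> lo k \<le> hi k"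
    and "sum lo A \<le> s" and "s \<le> sum hi A"
  shows "\<exists>f. (\<forall>k\<in>A. lo k \<le> f k \<and> f k \<le> hi k) \<and> sum f A = s"
  using assms
proof (induction A arbitrary: s rule: finite_induct)
  case empty
  then show ?case by simp
next
  case (insert a A)
  \<comment> \<open>The least admissible value at \<open>a\<close>: anything smaller would leave a
    remainder exceeding \<open>sum hi A\<close>.\<close>
  define t where "t = max (lo a) (s - sum hi A)"
  have le: "lo a \<le> hi a" "sum lo A \<le> sum hi A"
    using insert.prems(1) by (auto intro: sum_mono)
  have t: "lo a \<le> t" "t \<le> hi a" "sum lo A \<le> s - t" "s - t \<le> sum hi A" "t \<le> s"
    using insert.prems(2,3) insert.hyps le by (auto simp: t_def)
  then obtain f where f: "\<forall>k\<in>A. lo k \<le> f k \<and> f k \<le> hi k" "sum f A = s - t"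
    using insert.IH[of "s - t"] insert.prems(1) by auto
  have "sum (f(a := t)) A = sum f A"
    using insert.hyps(2) by (intro sum.cong) auto
  then have "sum (f(a := t)) (insert a A) = s"
    using f(2) t(5) insert.hyps by simp
  then show ?case
    using f(1) t(1,2) by (intro exI[of _ "f(a := t)"]) auto
qed

section \<open>Minimum and total along a move\<close>

lemma exco_min_le: "i \<in> {1..n} \<Longrightarrow> exco_min n x \<le> x ! i"
  unfolding exco_min_def by (intro Min_le) auto

lemma exco_min_attained:
  assumes "n \<ge> 1"
  obtains p where "p \<in> {1..n}" and "x ! p = exco_min n x"
proof -
  have "exco_min n x \<in> (\<lambda>i. x ! i) ` {1..n}"
    unfolding exco_min_def using assms by (intro Min_in) auto
  then show thesis
    using that by auto
qed

lemma exco_min_eqI: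
  assumes "p \<in> {1..n}" "x ! p = m" "\<And>i. i \<in> {1..n} \<Longrightarrow> m \<le> x ! i"
  shows "exco_min n x = m"
  unfolding exco_min_def using assms by (intro Min_eqI) auto

lemma sum_piles_split:
  fixes f :: "nat \<Rightarrow> nat"
  assumes "i \<in> {1..n}"
  shows "(\<Sum>j=0..n. f j) = f 0 + f i + (\<Sum>j\<in>{1..n} - {i}. f j)"
proof -
  have "(\<Sum>j=0..n. f j) = f 0 + (\<Sum>j\<in>{1..n}. f j)"
    by (simp add: sum.atLeast_Suc_atMost)
  also have "(\<Sum>j\<in>{1..n}. f j) = f i + (\<Sum>j\<in>{1..n} - {i}. f j)"
    using assms by (intro sum.remove) auto
  finally show ?thesis by simp
qed

lemma sum_piles_ge:
  fixes f :: "nat \<Rightarrow> nat"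
  assumes "i \<in> {1..n}" and "\<And>j. j \<in> {1..n} - {i} \<Longrightarrow> b \<le> f j"
  shows "f i + (n - 1) * b \<le> (\<Sum>j=0..n. f j)"
proof -
  have "(\<Sum>j\<in>{1..n} - {i}. b) \<le> (\<Sum>j\<in>{1..n} - {i}. f j)"
    using assms(2) by (rule sum_mono)
  then show ?thesis
    using assms(1) sum_piles_split[OF assms(1), of f] by simp
qed

lemma exco_sum_ge:
  assumes "n \<ge> 1"
  shows "n * exco_min n x \<le> (\<Sum>j=0..n. x ! j)"
proof -
  obtain p where p: "p \<in> {1..n}" "x ! p = exco_min n x"
    using assms by (rule exco_min_attained)
  have "x ! p + (n - 1) * exco_min n x \<le> (\<Sum>j=0..n. x ! j)"
    using p(1) by (intro sum_piles_ge exco_min_le) auto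
  moreover obtain k where "n = Suc k"
    using assms by (cases n) auto
  ultimately show ?thesis
    using p(2) by simp
qed

lemma exco_move_min_le:
  assumes "n \<ge> 1" and "exco_move n x x'"
  shows "exco_min n x' \<le> exco_min n x"
proof -
  obtain p where p: "p \<in> {1..n}" "x ! p = exco_min n x"
    using assms(1) by (rule exco_min_attained)
  have "x' ! p \<le> x ! p"
    using p(1) assms(2) by (auto simp: exco_move_def)
  then show ?thesis
    using p exco_min_le[OF p(1), of x'] by simp
qed

text \<open>The kept pile is at least the old minimum, each of the other \<open>n - 1\<close> piles
  at least the new one.\<close>

lemma exco_move_sum_ge:
  assumes "exco_move n x x'"
  shows "exco_min n x + (n - 1) * exco_min n x' \<le> (\<Sum>j=0..n. x' ! j)"
proof -
  obtain i where i: "i \<in> {1..n}" "x' ! i = x ! i"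
    using assms by (auto simp: exco_move_def)
  have "x' ! i + (n - 1) * exco_min n x' \<le> (\<Sum>j=0..n. x' ! j)"
    using i(1) by (intro sum_piles_ge exco_min_le) auto
  then show ?thesis
    using i exco_min_le[OF i(1), of x] by simp
qed

section \<open>Realising a prescribed minimum and total by a move\<close>

lemma exco_move_keep_lower:
  assumes pos: "exco_position n x"
    and i: "i \<in> {1..n}" and j: "j \<in> {1..n}" and "i \<noteq> j"
    and m': "m' \<le> exco_min n x"
    and lower: "x ! i + (n - 1) * m' \<le> u'"
    and upper: "u' + x ! j \<le> (\<Sum>k=0..n. x ! k) + m'"
    and less: "u' < (\<Sum>k=0..n. x ! k)"
  shows "\<exists>x'. exco_move n x x' \<and> exco_min n x' = m' \<and> (\<Sum>k=0..n. x' ! k) = u'"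
proof -
  have m'_le: "m' \<le> x ! k" if "k \<in> {1..n}" for k
    using m' exco_min_le[OF that, of x] by simp
  \<comment> \<open>The bounds coincide at \<open>i\<close>, which is kept, and at \<open>j\<close>,
    which drops to \<open>m'\<close>; all other entries are free. Their totals are the extremes in
    \<open>lower\<close> and \<open>upper\<close>.\<close>
  define lo where "lo k = (if k = 0 then 0 else if k = i then x ! i else m')" for k
  define hi where "hi k = (if k = j then m' else x ! k)" for k
  have "lo k \<le> hi k" if "k \<in> {0..n}" for k
    using m'_le[of k] that \<open>i \<noteq> j\<close> i j by (auto simp: lo_def hi_def)
  moreover have "sum lo {0..n} \<le> u'"
  proof -
    have "(\<Sum>k\<in>{1..n} - {i}. lo k) = (\<Sum>k\<in>{1..n} - {i}. m')"
      by (intro sum.cong) (auto simp: lo_def)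
    then show ?thesis
      using sum_piles_split[OF i, of lo] i lower by (simp add: lo_def)
  qed
  moreover have "u' \<le> sum hi {0..n}"
  proof -
    have "(\<Sum>k\<in>{1..n} - {j}. hi k) = (\<Sum>k\<in>{1..n} - {j}. x ! k)"
      by (intro sum.cong) (auto simp: hi_def)
    then show ?thesis
      using sum_piles_split[OF j, of hi] sum_piles_split[OF j, of "\<lambda>k. x ! k"] j upper
      by (simp add: hi_def)
  qed
  ultimately obtain f where f: "\<forall>k\<in>{0..n}. lo k \<le> f k \<and> f k \<le> hi k" "sum f {0..n} = u'"
    using exists_between_with_sum[of "{0..n}" lo hi u'] by auto
  define x' where "x' = map f [0..<n + 1]"
  have nth: "x' ! k = f k" if "k \<le> n" for k
    using that unfolding x'_def by (subst nth_map_upt) auto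
  have sum: "(\<Sum>k=0..n. x' ! k) = u'"
    using f(2) by (simp add: nth)
  have fi: "f i = x ! i"
    using bspec[OF f(1), of i] i \<open>i \<noteq> j\<close> by (simp add: lo_def hi_def)
  have fj: "f j = m'"
    using bspec[OF f(1), of j] j \<open>i \<noteq> j\<close> by (simp add: lo_def hi_def)
  have le: "x' ! k \<le> x ! k" if "k \<in> {0..n}" for k
    using bspec[OF f(1) that] that m'_le[OF j] by (auto simp: nth hi_def split: if_splits)
  have "exco_move n x x'"
    unfolding exco_move_def
  proof (intro conjI)
    show "exco_position n x'"
      by (simp add: exco_position_def x'_def)
    show "\<exists>k\<in>{1..n}. x' ! k = x ! k"
      using i fi nth[of i] by (intro bexI[of _ i]) auto
  qed (use pos le sum less in auto)
  moreover have "exco_min n x' = m'"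
  proof (rule exco_min_eqI[OF j])
    show "x' ! j = m'"
      using j fj nth[of j] by simp
    show "m' \<le> x' ! k" if "k \<in> {1..n}" for k
      using bspec[OF f(1), of k] that nth[of k] m'_le[OF i] by (auto simp: lo_def split: if_splits)
  qed
  ultimately show ?thesis
    using sum by blast
qed

text \<open>Keeping the smallest pile and lowering the second smallest covers small \<open>y'\<close>, exchanging their
  roles covers large \<open>y'\<close>; a third pile guarantees that the two ranges leave no gap.\<close>

lemma exco_move_exists:
  assumes n: "n \<ge> 3" and pos: "exco_position n x"
    and m': "m' \<le> exco_min n x"
    and lower: "exco_min n x \<le> m' + y'"
    and upper: "n * m' + y' + exco_min n x \<le> (\<Sum>k=0..n. x ! k) + m'"
    and less: "n * m' + y' < (\<Sum>k=0..n. x ! k)"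
  shows "\<exists>x'. exco_move n x x' \<and> exco_min n x' = m' \<and> (\<Sum>k=0..n. x' ! k) = n * m' + y'"
proof -
  define m where "m = exco_min n x"
  define u where "u = (\<Sum>k=0..n. x ! k)"
  obtain k where k: "n = k + 3"
    using n by (metis le_add_diff_inverse2)
  obtain p where p: "p \<in> {1..n}" "x ! p = m"
    using n exco_min_attained[of n x] unfolding m_def by auto
  define B where "B = (\<lambda>i. x ! i) ` ({1..n} - {p})"
  have "card ({1..n} - {p}) \<noteq> 0"
    using p(1) n by simp
  then have B: "finite B" "B \<noteq> {}"
    by (auto simp: B_def simp del: card_Diff_insert)
  from Min_in[OF B] obtain q where q: "q \<in> {1..n} - {p}" "x ! q = Min B"
    unfolding B_def by (metis (mono_tags, lifting) imageE)
  have q_le: "x ! q \<le> x ! i" if "i \<in> {1..n} - {p}" for i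
    using that B q(2) by (auto simp: B_def)
  have "m + 2 * (x ! q) + k * (x ! q) \<le> u"
    using sum_piles_ge[OF p(1), of "x ! q" "\<lambda>i. x ! i"] q_le p(2) by (simp add: u_def k)
  moreover have "k * m' \<le> k * (x ! q)"
    using q exco_min_le[of q n x] m' by (intro mult_le_mono) auto
  ultimately have u_ge: "m + 2 * (x ! q) + k * m' \<le> u"
    by linarith
  show ?thesis
  proof (cases "n * m' + y' + x ! q \<le> u + m'")
    case True
    show ?thesis
      by (rule exco_move_keep_lower[of n x p q])
        (use True pos p q m' lower less in \<open>auto simp: k m_def u_def algebra_simps\<close>)
  next
    case False
    \<comment> \<open>Of the two copies of \<open>x ! q\<close> in \<open>u_ge\<close>, one is used
      up by the failed case condition and the other pays for keeping pile \<open>q\<close>.\<close>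
    then have "x ! q + (n - 1) * m' \<le> n * m' + y'"
      using u_ge m' by (simp add: k m_def algebra_simps)
    then show ?thesis
      using exco_move_keep_lower[of n x q p] pos p q m' upper less by (auto simp: m_def)
  qed
qed

section \<open>Triangular numbers\<close>

lemma Suc_Suc_choose_two: "Suc (Suc a) choose 2 = (Suc a choose 2) + Suc a"
  by (simp add: numeral_2_eq_2)

lemma Suc_choose_two_mono: "a \<le> b \<Longrightarrow> Suc a choose 2 \<le> Suc b choose 2"
  by (induction rule: dec_induct) (simp_all add: Suc_Suc_choose_two)

text \<open>Makes the intervals \<open>{T a..T a + a}\<close> disjoint, so that a short value
  determines \<open>y\<close>.\<close>

lemma Suc_choose_two_gap: "a < b \<Longrightarrow> (Suc a choose 2) + Suc a \<le> Suc b choose 2"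
  using Suc_choose_two_mono[of "Suc a" b] by (simp add: Suc_Suc_choose_two)

lemma triangular_decomposition:
  obtains a r where "r \<le> a" and "v = (Suc a choose 2) + r"
proof -
  have "\<exists>a r. r \<le> a \<and> v = (Suc a choose 2) + r"
  proof (induction v)
    case 0
    show ?case by (intro exI[of _ 0]) simp
  next
    case (Suc v)
    then obtain a r where ar: "r \<le> a" "v = (Suc a choose 2) + r"
      by blast
    show ?case
    proof (cases "r = a")
      case True
      then show ?thesis
        using ar by - (rule exI[of _ "Suc a"], rule exI[of _ 0], simp add: Suc_Suc_choose_two)
    next
      case False
      then show ?thesis
        using ar by - (rule exI[of _ a], rule exI[of _ "Suc r"], simp)
    qed
  qed
  then show thesis
    using that by blast
qed

lemma triangular_decomposition_unique:
  assumes "(Suc a choose 2) + r = (Suc b choose 2) + s" "r \<le> a" "s \<le> b"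
  shows "a = b"
  using Suc_choose_two_gap[of a b] Suc_choose_two_gap[of b a] assms
  by (cases a b rule: linorder_cases) auto

section \<open>The value as a function of minimum and excess\<close>

text \<open>The formula with \<open>z = Suc (Suc y choose 2)\<close> substituted, freed from the
  position so that the rest is arithmetic.\<close>

definition exco_value :: "nat \<Rightarrow> nat \<Rightarrow> nat \<Rightarrow> nat" where
  "exco_value n m y =
     (if m \<le> Suc y choose 2 then n * m + y
      else (Suc y choose 2) + (m - Suc (Suc y choose 2)) mod Suc y)"

lemma exco_formula_eq_value:
  assumes "exco_min n x = m" and "(\<Sum>i=0..n. x ! i) = n * m + y"
  shows "exco_formula n x = exco_value n m y"
  using assms by (auto simp: exco_formula_def exco_value_def Let_def)

lemma exco_value_long: "m \<le> Suc y choose 2 \<Longrightarrow> exco_value n m y = n * m + y"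
  by (simp add: exco_value_def)

lemma exco_value_short:
  assumes "Suc y choose 2 < m"
  shows "exco_value n m y = (Suc y choose 2) + (m - Suc (Suc y choose 2)) mod Suc y"
  using assms by (simp add: exco_value_def)

text \<open>A residue is at most its dividend, here \<open>m - T y - 1\<close>.\<close>

lemma exco_value_less_min:
  assumes "Suc y choose 2 < m"
  shows "exco_value n m y < m"
  using mod_less_eq_dividend[of "m - Suc (Suc y choose 2)" "Suc y"] assms
  unfolding exco_value_short[OF assms] by linarith

lemma exco_value_le:
  assumes "n \<ge> 1"
  shows "exco_value n m y \<le> n * m + y"
proof (cases "m \<le> Suc y choose 2")
  case True
  then show ?thesis by (simp add: exco_value_long)
next
  case False
  then have "exco_value n m y < m" 
    by (simp add: exco_value_less_min)
  also have "m \<le> n * m"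
    using assms by simp
  finally show ?thesis by simp
qed

lemma exco_value_neq:
  assumes n: "n \<ge> 1" and "m' \<le> m" and y': "m \<le> m' + y'"
    and less: "n * m' + y' < n * m + y"
  shows "exco_value n m' y' \<noteq> exco_value n m y"
proof (cases "m \<le> Suc y choose 2")
  case True
  then show ?thesis
    using exco_value_le[OF n, of m' y'] less by (simp add: exco_value_long)
next
  case short: False
  show ?thesis
  proof (cases "m' \<le> Suc y' choose 2")
    case True
    have "m' \<le> n * m'"
      using n by simp
    then have "m \<le> n * m' + y'"
      using y' by linarith
    then show ?thesis
      using True short exco_value_less_min[of y m n] by (simp add: exco_value_long)
  next
    case short': False
    show ?thesis
    proof
      assume eq: "exco_value n m' y' = exco_value n m y"
      then have "(Suc y' choose 2) + (m' - Suc (Suc y' choose 2)) mod Suc y'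
          = (Suc y choose 2) + (m - Suc (Suc y choose 2)) mod Suc y"
        using short short' by (simp add: exco_value_short)
      then have "y' = y"
        by (rule triangular_decomposition_unique) (simp_all add: less_Suc_eq_le[symmetric])
      define t where "t = Suc (Suc y choose 2)"
      have "(m - t) mod Suc y = (m' - t) mod Suc y"
        using eq short short' by (simp add: exco_value_short \<open>y' = y\<close> t_def)
      \<comment> \<open>Equal residues make \<open>m - m'\<close> a multiple of
        \<open>y + 1\<close>, yet it is at most \<open>y\<close>; so it vanishes and the totals
        agree.\<close>
      then have "Suc y dvd (m - t) - (m' - t)"
        by (rule mod_eq_dvd_iff_nat[THEN iffD1, rotated]) (use \<open>m' \<le> m\<close> in simp)
      moreover have "(m - t) - (m' - t) = m - m'"
        using short' \<open>m' \<le> m\<close> by (simp add: t_def \<open>y' = y\<close>)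
      ultimately have "Suc y dvd m - m'"
        by simp
      moreover have "m - m' \<le> y"
        using y' \<open>y' = y\<close> by simp
      ultimately have "m - m' = 0"
        by (metis dvd_imp_le gr0I not_less_eq_eq)
      then have "m' = m"
        using \<open>m' \<le> m\<close> by simp
      then show False
        using less \<open>y' = y\<close> by simp
    qed
  qed
qed

text \<open>With \<open>v = T a + r\<close>, take \<open>y' = a\<close> and for \<open>m'\<close>
  the largest number up to \<open>m\<close> congruent to \<open>v + 1\<close> modulo
  \<open>a + 1\<close>; the deficit \<open>m - m'\<close> is then at most \<open>a\<close>.\<close>

lemma exco_value_hit_short:
  assumes "v < m" and "v < Suc y choose 2" and "n \<ge> 1"
  shows "\<exists>m' y'. m' \<le> m \<and> m \<le> m' + y' \<and> n * m' + y' + m \<le> n * m + y + m' \<and>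
    n * m' + y' < n * m + y \<and> exco_value n m' y' = v"
proof -
  obtain a r where ar: "r \<le> a" "v = (Suc a choose 2) + r"
    by (rule triangular_decomposition)
  have "a < y"
    using Suc_choose_two_mono[of y a] ar assms(2) by (cases "a < y") auto
  define q where "q = (m - Suc v) div Suc a"
  define d where "d = (m - Suc v) mod Suc a"
  have "m - Suc v = q * Suc a + d"
    unfolding q_def d_def by (rule div_mult_mod_eq[symmetric])
  then have m: "m = Suc v + q * Suc a + d"
    using assms(1) by simp
  have "d \<le> a"
    by (simp add: d_def less_Suc_eq_le[symmetric])
  define m' where "m' = Suc v + q * Suc a"
  have md: "m = m' + d"
    using m by (simp add: m'_def)
  obtain k where k: "n = Suc k"
    using assms(3) by (cases n) auto
  have "m' - Suc (Suc a choose 2) = r + q * Suc a"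
    by (simp add: m'_def ar(2))
  then have "(m' - Suc (Suc a choose 2)) mod Suc a = r"
    using ar(1) by (simp only: mod_mult_self1) simp
  moreover have "Suc a choose 2 < m'"
    by (simp add: m'_def ar(2))
  ultimately have "exco_value n m' a = v"
    using ar(2) by (simp add: exco_value_short)
  then show ?thesis
    using \<open>d \<le> a\<close> \<open>a < y\<close>
    by - (rule exI[of _ m'], rule exI[of _ a], auto simp: md k algebra_simps)
qed

lemma exco_value_hit:
  assumes "n \<ge> 2" and v: "v < exco_value n m y"
  shows "\<exists>m' y'. m' \<le> m \<and> m \<le> m' + y' \<and> n * m' + y' + m \<le> n * m + y + m' \<and>
    n * m' + y' < n * m + y \<and> exco_value n m' y' = v"
proof (cases "v < m \<and> v < Suc y choose 2")
  case True
  then show ?thesis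
    using exco_value_hit_short[of v m y n] assms(1) by auto
next
  case hit: False
  obtain k where k: "n = Suc k" "k \<noteq> 0"
    using assms(1) by (cases n) auto
  show ?thesis
  proof (cases "m \<le> Suc y choose 2")
    case long: True
    then have "v < n * m + y"
      using v by (simp add: exco_value_long)
    have "m \<le> v"
      using hit long by auto
    show ?thesis
    proof (cases "v + m \<le> n * m + y")
      case True
      \<comment> \<open>With minimum \<open>0\<close> every position is long, so total
        \<open>v\<close> gives value \<open>v\<close>.\<close>
      then show ?thesis
        using \<open>m \<le> v\<close> \<open>v < n * m + y\<close>
        by - (rule exI[of _ 0], rule exI[of _ v], auto simp: exco_value_long)
    next
      case False
      \<comment> \<open>Here \<open>d < m\<close>. Lowering both minimum and total by
        \<open>d\<close> raises the excess to \<open>y + (n - 1) * d\<close>, so the position stays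
        long; \<open>k \<noteq> 0\<close> gives \<open>d \<le> y'\<close>.\<close>
      define d where "d = n * m + y - v"
      define m' where "m' = m - d"
      have d: "v + d = n * m + y" "0 < d" "m = m' + d"
        using False \<open>v < n * m + y\<close> by (auto simp: d_def m'_def)
      have "m' \<le> Suc (y + k * d) choose 2"
        using long d(3) Suc_choose_two_mono[of y "y + k * d"] by simp
      then have val: "exco_value n m' (y + k * d) = n * m' + (y + k * d)"
        by (rule exco_value_long)
      have veq: "v = n * m' + (y + k * d)"
        using d(1) by (simp add: k(1) d(3) algebra_simps)
      have "d \<le> y + k * d"
        using k(2) by (cases k) auto
      then show ?thesis
        using val veq d
        by - (rule exI[of _ m'], rule exI[of _ "y + k * d"], auto simp: k(1) algebra_simps)
    qed
  next
    case short: False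
    define T where "T = Suc y choose 2"
    define r where "r = (m - Suc T) mod Suc y"
    have "v < T + r"
      using v short by (simp add: exco_value_short T_def r_def)
    moreover have "T \<le> v"
      using hit short by (auto simp: T_def)
    ultimately obtain s where s: "v = T + s" "s < r"
      by (metis le_Suc_ex nat_add_left_cancel_less)
    have "r \<le> y"
      by (simp add: r_def less_Suc_eq_le[symmetric])
    define q where "q = (m - Suc T) div Suc y"
    have "m - Suc T = q * Suc y + r"
      unfolding q_def r_def by (rule div_mult_mod_eq[symmetric])
    then have m: "m = Suc T + q * Suc y + r"
      using short by (simp add: T_def)
    \<comment> \<open>Keeping \<open>y\<close> and the quotient \<open>q\<close>, only the residue
      falls from \<open>r\<close> to \<open>s\<close>; the drop is at most \<open>y\<close>.\<close>
    define m' where "m' = Suc T + q * Suc y + s"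
    define d where "d = r - s"
    have md: "m = m' + d" "0 < d" "d \<le> y"
      using m s \<open>r \<le> y\<close> by (auto simp: m'_def d_def)
    have "m' - Suc T = s + q * Suc y"
      by (simp add: m'_def)
    then have "(m' - Suc T) mod Suc y = s"
      using s \<open>r \<le> y\<close> by (simp only: mod_mult_self1) simp
    moreover have "Suc y choose 2 < m'"
      by (simp add: m'_def T_def)
    ultimately have "exco_value n m' y = v"
      using s(1) by (simp add: exco_value_short T_def)
    then show ?thesis
      using md by - (rule exI[of _ m'], rule exI[of _ y], auto simp: k(1) algebra_simps)
  qed
qed

section \<open>Induction along moves\<close>

theorem theorem3p1:
  fixes n :: nat and x :: "nat list"
  assumes "n \<ge> 3" and "exco_position n x"
  shows "exco_grundy n x = exco_formula n x"
  using assms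
proof (induction n x rule: exco_grundy.induct)
  case (1 n x)
  define m where "m = exco_min n x"
  define u where "u = (\<Sum>j=0..n. x ! j)"
  define y where "y = u - n * m"
  have n: "n \<ge> 1"
    using 1(2) by simp
  have u: "u = n * m + y"
    using exco_sum_ge[OF n, of x] by (simp add: y_def u_def m_def)
  have val: "exco_formula n x = exco_value n m y"
    using u by (intro exco_formula_eq_value) (simp_all add: m_def u_def)
  have IH: "exco_grundy n x' = exco_formula n x'" if "exco_move n x x'" for x'
    using 1 that by (auto simp: exco_move_def)
  have "exco_formula n x \<notin> exco_grundy n ` {x'. exco_move n x x'}"
  proof
    assume "exco_formula n x \<in> exco_grundy n ` {x'. exco_move n x x'}"
    then obtain x' where x': "exco_move n x x'" "exco_formula n x' = exco_formula n x"
      using IH by auto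
    define m' where "m' = exco_min n x'"
    define y' where "y' = (\<Sum>j=0..n. x' ! j) - n * m'"
    have u': "(\<Sum>j=0..n. x' ! j) = n * m' + y'"
      using exco_sum_ge[OF n, of x'] by (simp add: y'_def m'_def)
    have "m + (n - 1) * m' \<le> n * m' + y'"
      using exco_move_sum_ge[OF x'(1)] u' by (simp add: m_def m'_def)
    \<comment> \<open>Cancelling \<open>(n - 1) * m'\<close> yields the form needed by
      \<open>exco_value_neq\<close>.\<close>
    then have "m \<le> m' + y'"
      using n by (cases n) auto
    moreover have "m' \<le> m"
      using exco_move_min_le[OF n x'(1)] by (simp add: m_def m'_def)
    moreover have "n * m' + y' < n * m + y"
      using x'(1) u u' by (simp add: exco_move_def u_def)
    ultimately have "exco_value n m' y' \<noteq> exco_value n m y"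
      using n by (intro exco_value_neq)
    moreover have "exco_formula n x' = exco_value n m' y'"
      using u' by (intro exco_formula_eq_value) (simp_all add: m'_def)
    ultimately show False
      using x'(2) val by simp
  qed
  moreover have "v \<in> exco_grundy n ` {x'. exco_move n x x'}" if v: "v < exco_formula n x" for v
  proof -
    \<comment> \<open>The inequalities are exactly those under which \<open>exco_move_exists\<close>
      supplies a successor.\<close>
    obtain m' y' where *: "m' \<le> m" "m \<le> m' + y'" "n * m' + y' + m \<le> n * m + y + m'"
        "n * m' + y' < n * m + y" "exco_value n m' y' = v"
      using exco_value_hit[of n v m y] 1(2) v val by auto
    then obtain x' where x': "exco_move n x x'" "exco_min n x' = m'"
        "(\<Sum>k=0..n. x' ! k) = n * m' + y'"
      using exco_move_exists[OF 1(2,3), of m' y'] u by (auto simp: m_def u_def)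
    then have "exco_grundy n x' = v"
      using IH[OF x'(1)] exco_formula_eq_value[OF x'(2,3)] *(5) by simp
    then show ?thesis
      using x'(1) by auto
  qed
  ultimately have "mex (exco_grundy n ` {x'. exco_move n x x'}) = exco_formula n x"
    by (rule mex_eqI)
  then show ?case
    by (subst exco_grundy.simps)
qed

end
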